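(* Suppose that $U$ satisfies either Assumption B or Assumption C and that $U$ is strictly increasing and continuously differentiable. Suppose furthermore that $S$ satisfies (NA) and is bounded, and that Assumption A (well-posedness) holds. Let $c\in\mathbb{R}$ and let $\phi^*=\phi^*(c)$ be an optimal strategy for initial capital $c$ (one exists under these hypotheses), i.e. $\phi^*\in\Phi(U,c)$ and $EU(V_T^{c,\phi^*})=\sup_{\phi\in\Phi(U,c)}EU(V_T^{c,\phi})<\infty$. Then $$\frac{dQ}{dP}:=\frac{U'(V_T^{c,\phi^*})}{E\,U'(V_T^{c,\phi^*})}$$ defines an equivalent martingale measure, i.e. a probability measure $Q\sim P$ such that $S$ is a $Q$-martingale.
   Context: Market: $(\Omega,\mathcal F,P)$ is a probability space with a filtration $(\mathcal F_t)_{0\le t\le T}$ ($T$ a finite integer horizon), $\mathcal F_0$ contains all $P$-null sets, and $(S_t)_{0\le t\le T}$ is an $\mathbb{R}^d$-valued adapted process; $\Delta S_t:=S_t-S_{t-1}$. $\Xi_t$ is the set of $\mathcal F_t$-measurable $\mathbb{R}^d$-valued random variables. A strategy is a predictable process $\phi=(\phi_t)_{1\le t\le T}$, i.e. $\phi_t\in\Xi_{t-1}$; $\Phi$ is the set of all strategies. For $c\in\mathbb{R}$, $V_t^{c,\phi}:=c+\sum_{i=1}^t\langle\phi_i,\Delta S_i\rangle$. $U:\mathbb{R}\to\mathbb{R}$ is a concave nondecreasing function. $\Phi(U,c)$ is the set of $\phi\in\Phi$ for which the expectation $EU(V_T^{c,\phi})$ is well defined. Conditional expectations are in the generalized sense ($E(X|\mathcal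 G)=E(X^+|\mathcal G)-E(X^-|\mathcal G)$ whenever this is not $\infty-\infty$). (NA): for all $\phi\in\Phi$, if $V_T^{0,\phi}\ge 0$ a.s. then $V_T^{0,\phi}=0$ a.s. Assumption A: the following random functions are well defined: $U_T(x):=U(x)$, and for $0\le t<T$, $x\in\mathbb{R}$, $U_t(x):=\operatorname{ess\,sup}_{\xi\in\Xi_t}E(U_{t+1}(x+\langle\xi,\Delta S_{t+1}\rangle)|\mathcal F_t)<\infty$ a.s. (where regular versions of $U_{t+1}$, i.e. a.s. nondecreasing, concave and finite-valued in $x$, are used), and $EU_0(x)<\infty$ for all $x\in\mathbb{R}$. Assumption B: $U$ is concave, nondecreasing, $U(0)=0$, and there exist $\tilde x>0$ and $0<\gamma<1$ such that $U(\lambda x)\le\lambda^\gamma U(x)$ for all $x\ge\tilde x$ and all $\lambda\ge1$. Assumption C: $U$ is concave, nondecreasing, $U(0)=0$, and there exist $\alpha>0$ and $\tilde x\le0$ such that $U(\lambda x)\le\lambda^{1+\alpha}U(x)$ for all $x\le\tilde x$ and all $\lambda\ge1$. *)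

theory Defs
  imports "HOL-Probability.Probability"
begin

section \<open>Generalized expectations and essential suprema of families\<close>

text \<open>
  For ereal, \<open>\<infinity> - \<infinity> = \<infinity>\<close>; the undefined case is ruled out separately by the
  predicates \<open>expectation_defined\<close> and \<open>cond_exp_defined\<close>. Note that \<open>ennreal\<close>
  truncates negative reals to 0, so \<open>ennreal (X \<omega>)\<close> and \<open>ennreal (- X \<omega>)\<close> are the
  positive and the negative part of \<open>X\<close>.
\<close>

definition gen_expectation :: "'a measure \<Rightarrow> ('a \<Rightarrow> real) \<Rightarrow> ereal" where
  "gen_expectation M X =
     enn2ereal (\<integral>\<^sup>+\<omega>. ennreal (X \<omega>) \<partial>M) - enn2ereal (\<integral>\<^sup>+\<omega>. ennreal (- X \<omega>) \<partial>M)"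

definition expectation_defined :: "'a measure \<Rightarrow> ('a \<Rightarrow> real) \<Rightarrow> bool" where
  "expectation_defined M X \<longleftrightarrow>
     X \<in> borel_measurable M \<and>
     ((\<integral>\<^sup>+\<omega>. ennreal (X \<omega>) \<partial>M) < \<infinity> \<or> (\<integral>\<^sup>+\<omega>. ennreal (- X \<omega>) \<partial>M) < \<infinity>)"

definition gen_cond_exp :: "'a measure \<Rightarrow> 'a measure \<Rightarrow> ('a \<Rightarrow> real) \<Rightarrow> 'a \<Rightarrow> ereal" where
  "gen_cond_exp M G X \<omega> =
     enn2ereal (nn_cond_exp M G (\<lambda>\<omega>. ennreal (X \<omega>)) \<omega>)
     - enn2ereal (nn_cond_exp M G (\<lambda>\<omega>. ennreal (- X \<omega>)) \<omega>)"

definition cond_exp_defined :: "'a measure \<Rightarrow> 'a measure \<Rightarrow> ('a \<Rightarrow> real) \<Rightarrow> bool" where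
  "cond_exp_defined M G X \<longleftrightarrow>
     X \<in> borel_measurable M \<and>
     (AE \<omega> in M. nn_cond_exp M G (\<lambda>\<omega>. ennreal (X \<omega>)) \<omega> < \<infinity> \<or>
                 nn_cond_exp M G (\<lambda>\<omega>. ennreal (- X \<omega>)) \<omega> < \<infinity>)"

text \<open>
  The essential supremum of a (possibly uncountable) family of random variables: the a.s. least
  random variable dominating each member a.s. This is not the library constant \<open>esssup\<close>,
  which is the essential supremum of a single function.
\<close>

definition is_ess_sup :: "'a measure \<Rightarrow> ('a \<Rightarrow> ereal) set \<Rightarrow> ('a \<Rightarrow> ereal) \<Rightarrow> bool" where
  "is_ess_sup M \<X> Y \<longleftrightarrow>
     Y \<in> borel_measurable M \<and>
     (\<forall>X\<in>\<X>. AE \<omega> in M. X \<omega> \<le> Y \<omega>) \<and>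
     (\<forall>Z\<in>borel_measurable M. (\<forall>X\<in>\<X>. AE \<omega> in M. X \<omega> \<le> Z \<omega>) \<longrightarrow> (AE \<omega> in M. Y \<omega> \<le> Z \<omega>))"


section \<open>The market\<close>

text \<open>Only the times \<open>0, ..., T\<close> matter; \<open>F\<close> and \<open>S\<close> are unconstrained afterwards.\<close>

locale market = prob_space M
  for M :: "'a measure" +
  fixes F :: "nat \<Rightarrow> 'a measure" and T :: nat and S :: "nat \<Rightarrow> 'a \<Rightarrow> real ^ 'd"
  assumes subalg: "t \<le> T \<Longrightarrow> subalgebra M (F t)"
    and filtration_mono: "s \<le> t \<Longrightarrow> t \<le> T \<Longrightarrow> sets (F s) \<subseteq> sets (F t)"
    and null_sets_F0: "null_sets M \<subseteq> sets (F 0)"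
    and adapted: "t \<le> T \<Longrightarrow> S t \<in> borel_measurable (F t)"

definition strategies :: "(nat \<Rightarrow> 'a measure) \<Rightarrow> nat \<Rightarrow> (nat \<Rightarrow> 'a \<Rightarrow> real ^ 'd) set" where
  "strategies F T = {\<phi>. \<forall>t\<in>{1..T}. \<phi> t \<in> borel_measurable (F (t - 1))}"

definition wealth ::
    "(nat \<Rightarrow> 'a \<Rightarrow> real ^ 'd) \<Rightarrow> real \<Rightarrow> (nat \<Rightarrow> 'a \<Rightarrow> real ^ 'd) \<Rightarrow> nat \<Rightarrow> 'a \<Rightarrow> real" where
  "wealth S c \<phi> t \<omega> = c + (\<Sum>i=1..t. \<phi> i \<omega> \<bullet> (S i \<omega> - S (i - 1) \<omega>))"

definition no_arbitrage ::
    "'a measure \<Rightarrow> (nat \<Rightarrow> 'a measure) \<Rightarrow> nat \<Rightarrow> (nat \<Rightarrow> 'a \<Rightarrow> real ^ 'd) \<Rightarrow> bool" where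
  "no_arbitrage M F T S \<longleftrightarrow>
     (\<forall>\<phi>\<in>strategies F T. (AE \<omega> in M. wealth S 0 \<phi> T \<omega> \<ge> 0) \<longrightarrow> (AE \<omega> in M. wealth S 0 \<phi> T \<omega> = 0))"

definition bounded_process ::
    "'a measure \<Rightarrow> nat \<Rightarrow> (nat \<Rightarrow> 'a \<Rightarrow> real ^ 'd) \<Rightarrow> bool" where
  "bounded_process M T S \<longleftrightarrow> (\<exists>K. \<forall>t\<le>T. AE \<omega> in M. norm (S t \<omega>) \<le> K)"


section \<open>Utility maximization\<close>

definition admissible ::
    "'a measure \<Rightarrow> (nat \<Rightarrow> 'a measure) \<Rightarrow> nat \<Rightarrow> (nat \<Rightarrow> 'a \<Rightarrow> real ^ 'd) \<Rightarrow> (real \<Rightarrow> real) \<Rightarrow> real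
      \<Rightarrow> (nat \<Rightarrow> 'a \<Rightarrow> real ^ 'd) set" where
  "admissible M F T S U c =
     {\<phi>\<in>strategies F T. expectation_defined M (\<lambda>\<omega>. U (wealth S c \<phi> T \<omega>))}"

definition optimal_strategy ::
    "'a measure \<Rightarrow> (nat \<Rightarrow> 'a measure) \<Rightarrow> nat \<Rightarrow> (nat \<Rightarrow> 'a \<Rightarrow> real ^ 'd) \<Rightarrow> (real \<Rightarrow> real) \<Rightarrow> real
      \<Rightarrow> (nat \<Rightarrow> 'a \<Rightarrow> real ^ 'd) \<Rightarrow> bool" where
  "optimal_strategy M F T S U c \<phi> \<longleftrightarrow>
     \<phi> \<in> admissible M F T S U c \<and>
     gen_expectation M (\<lambda>\<omega>. U (wealth S c \<phi> T \<omega>)) =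
       (SUP \<psi>\<in>admissible M F T S U c. gen_expectation M (\<lambda>\<omega>. U (wealth S c \<psi> T \<omega>))) \<and>
     (SUP \<psi>\<in>admissible M F T S U c. gen_expectation M (\<lambda>\<omega>. U (wealth S c \<psi> T \<omega>))) < \<infinity>"

text \<open>
  \<open>V t \<omega> x\<close> is a regular version of the random function \<open>U\<^sub>t(x)\<close>. That \<open>V\<close> is
  real-valued encodes finiteness. Since regularity is only required a.s. and \<open>M\<close> need not be
  complete, joint measurability is what makes \<open>V (Suc t) \<omega> (x + \<xi> \<omega> \<bullet> \<Delta>S \<omega>)\<close> a random
  variable; an a.s. regular version can always be modified on a null set (which belongs to
  \<open>F 0\<close>) so as to be jointly measurable.
\<close>

definition value_functions ::
    "'a measure \<Rightarrow> (nat \<Rightarrow> 'a measure) \<Rightarrow> nat \<Rightarrow> (nat \<Rightarrow> 'a \<Rightarrow> real ^ 'd) \<Rightarrow> (real \<Rightarrow> real)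
      \<Rightarrow> (nat \<Rightarrow> 'a \<Rightarrow> real \<Rightarrow> real) \<Rightarrow> bool" where
  "value_functions M F T S U V \<longleftrightarrow>
     V T = (\<lambda>_. U) \<and>
     (\<forall>t<T.
        (\<lambda>(\<omega>, x). V t \<omega> x) \<in> borel_measurable (F t \<Otimes>\<^sub>M borel) \<and>
        (AE \<omega> in M. mono (V t \<omega>) \<and> concave_on UNIV (V t \<omega>)) \<and>
        (\<forall>x.
          (\<forall>\<xi>\<in>borel_measurable (F t).
             cond_exp_defined M (F t) (\<lambda>\<omega>. V (Suc t) \<omega> (x + \<xi> \<omega> \<bullet> (S (Suc t) \<omega> - S t \<omega>)))) \<and>
          is_ess_sup M
            ((\<lambda>\<xi>. gen_cond_exp M (F t) (\<lambda>\<omega>. V (Suc t) \<omega> (x + \<xi> \<omega> \<bullet> (S (Suc t) \<omega> - S t \<omega>))))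
               ` borel_measurable (F t))
            (\<lambda>\<omega>. ereal (V t \<omega> x))))"

definition well_posed ::
    "'a measure \<Rightarrow> (nat \<Rightarrow> 'a measure) \<Rightarrow> nat \<Rightarrow> (nat \<Rightarrow> 'a \<Rightarrow> real ^ 'd) \<Rightarrow> (real \<Rightarrow> real) \<Rightarrow> bool" where
  "well_posed M F T S U \<longleftrightarrow>
     (\<exists>V. value_functions M F T S U V \<and> (\<forall>x. gen_expectation M (\<lambda>\<omega>. V 0 \<omega> x) < \<infinity>))"

definition assumption_B :: "(real \<Rightarrow> real) \<Rightarrow> bool" where
  "assumption_B U \<longleftrightarrow>
     concave_on UNIV U \<and> mono U \<and> U 0 = 0 \<and>
     (\<exists>x0>0. \<exists>\<gamma>>0. \<gamma> < 1 \<and> (\<forall>x\<ge>x0. \<forall>l\<ge>1. U (l * x) \<le> l powr \<gamma> * U x))"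

definition assumption_C :: "(real \<Rightarrow> real) \<Rightarrow> bool" where
  "assumption_C U \<longleftrightarrow>
     concave_on UNIV U \<and> mono U \<and> U 0 = 0 \<and>
     (\<exists>\<alpha>>0. \<exists>x0\<le>0. \<forall>x\<le>x0. \<forall>l\<ge>1. U (l * x) \<le> l powr (1 + \<alpha>) * U x)"


section \<open>Equivalent martingale measures\<close>

text \<open>The conditional expectation of an \<open>\<real>\<^sup>d\<close>-valued random variable is taken componentwise.\<close>

definition is_martingale ::
    "'a measure \<Rightarrow> (nat \<Rightarrow> 'a measure) \<Rightarrow> nat \<Rightarrow> (nat \<Rightarrow> 'a \<Rightarrow> real ^ 'd) \<Rightarrow> bool" where
  "is_martingale Q F T S \<longleftrightarrow>
     (\<forall>t\<le>T. S t \<in> borel_measurable (F t) \<and> integrable Q (S t)) \<and>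
     (\<forall>t\<le>T. \<forall>s\<le>t. \<forall>i. AE \<omega> in Q. real_cond_exp Q (F s) (\<lambda>\<omega>. S t \<omega> $ i) \<omega> = S s \<omega> $ i)"

definition equivalent_martingale_measure ::
    "'a measure \<Rightarrow> (nat \<Rightarrow> 'a measure) \<Rightarrow> nat \<Rightarrow> (nat \<Rightarrow> 'a \<Rightarrow> real ^ 'd) \<Rightarrow> 'a measure \<Rightarrow> bool" where
  "equivalent_martingale_measure M F T S Q \<longleftrightarrow>
     prob_space Q \<and> sets Q = sets M \<and>
     absolutely_continuous M Q \<and> absolutely_continuous Q M \<and>
     is_martingale Q F T S"

end

theory Submission
  imports Defs
begin

text \<open>
  Write \<open>W\<close> for the optimal terminal wealth and let \<open>X\<close> be a bounded terminal wealth attained from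
  the same capital. Since \<open>U ((1 - e) W + e X) \<ge> (1 - e) U W + e U X\<close> and the right side is integrable,
  convex combinations of the two strategies are admissible, so \<open>(U (W + e (X - W)) - U W) / e\<close> has
  nonpositive expectation. These quotients are bounded below by \<open>U X - U W\<close> and converge as
  \<open>e \<rightarrow> 0\<close>, whence \<open>E (U' W (X - W)) \<le> 0\<close> with an integrable integrand. For \<open>X = c\<close> this makes
  \<open>U' W\<close> integrable, because \<open>U' W\<close> is bounded where \<open>W \<ge> c - 1\<close> and dominated by \<open>\<bar>U' W (c - W)\<bar>\<close>
  elsewhere. For \<open>X = c + r Y\<close> with \<open>Y\<close> a bounded gain and \<open>r\<close> an arbitrary real number it gives
  \<open>E (U' W Y) = 0\<close>, the martingale property under \<open>Q\<close>.
\<close>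

section \<open>Tangents and derivative bounds for concave functions\<close>

lemma concave_above_tangent:
  fixes U :: "real \<Rightarrow> real"
  assumes "concave_on UNIV U" "(U has_real_derivative d) (at x)"
  shows "U y - U x \<le> d * (y - x)"
proof -
  have "- U y - - U x \<ge> - d * (y - x)"
    by (rule convex_on_imp_above_tangent[where A = UNIV])
       (use assms in \<open>auto simp: concave_on_def intro!: derivative_eq_intros\<close>)
  then show ?thesis by simp
qed

text \<open>The tangent at \<open>x\<close> dominates \<open>U\<close> at \<open>x + 1\<close>, so
  \<open>d\<close> is at least the strictly positive increment \<open>U (x + 1) - U x\<close>.
  Concavity thus excludes the isolated zeros of the derivative that strict monotonicity alone would
  permit.\<close>

lemma concave_strict_mono_derivative_pos:
  fixes U :: "real \<Rightarrow> real"
  assumes "concave_on UNIV U" "strict_mono U" "(U has_real_derivative d) (at x)"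
  shows "0 < d"
proof -
  have "U (x + 1) - U x \<le> d" using concave_above_tangent[OF assms(1,3), of "x + 1"] by simp
  moreover have "U x < U (x + 1)" using assms(2) by (simp add: strict_mono_def)
  ultimately show ?thesis by simp
qed

text \<open>This is the dominating function that yields integrability of the marginal utility. At
  distance at least 1 from \<open>c\<close> the factor \<open>\<bar>c - w\<bar>\<close> only helps;
  closer to \<open>c\<close>, both \<open>w - 1\<close> and \<open>w\<close> lie between
  \<open>c - 2\<close> and \<open>c + 1\<close>, and the slope at \<open>w\<close> is at most the
  increment of \<open>U\<close> over the unit interval to its left.\<close>

lemma concave_mono_derivative_le:
  fixes U :: "real \<Rightarrow> real"
  assumes U: "concave_on UNIV U" "mono U" and d: "(U has_real_derivative d) (at w)" "0 \<le> d"
  shows "d \<le> \<bar>d * (c - w)\<bar> + (U (c + 1) - U (c - 2))"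
proof (cases "\<bar>c - w\<bar> \<ge> 1")
  case True
  then have "d * 1 \<le> d * \<bar>c - w\<bar>" using d(2) by (intro mult_left_mono)
  also have "\<dots> = \<bar>d * (c - w)\<bar>" using d(2) by (simp add: abs_mult)
  finally show ?thesis using monoD[OF U(2), of "c - 2" "c + 1"] by simp
next
  case False
  have "d \<le> U w - U (w - 1)" using concave_above_tangent[OF U(1) d(1), of "w - 1"] by simp
  also have "\<dots> \<le> U (c + 1) - U (c - 2)"
    using False by (intro diff_mono; intro monoD[OF U(2)]) linarith+
  finally show ?thesis by simp
qed

section \<open>Generalized expectations and a one-sided limit theorem\<close>

lemma gen_expectation_eq_integral:
  assumes "integrable M f"
  shows "gen_expectation M f = ereal (\<integral>\<omega>. f \<omega> \<partial>M)"
proof -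
  have "(\<integral>\<^sup>+\<omega>. ennreal (f \<omega>) \<partial>M) \<noteq> \<infinity>" "(\<integral>\<^sup>+\<omega>. ennreal (- f \<omega>) \<partial>M) \<noteq> \<infinity>"
    using assms by (auto simp: real_integrable_def)
  then show ?thesis
    unfolding gen_expectation_def real_lebesgue_integral_def[OF assms]
    by (cases "\<integral>\<^sup>+\<omega>. ennreal (f \<omega>) \<partial>M"; cases "\<integral>\<^sup>+\<omega>. ennreal (- f \<omega>) \<partial>M")
       auto
qed

lemma integrable_if_gen_expectation_finite:
  assumes "expectation_defined M f" "\<bar>gen_expectation M f\<bar> \<noteq> \<infinity>"
  shows "integrable M f"
  using assms unfolding expectation_defined_def gen_expectation_def real_integrable_def
  by (cases "\<integral>\<^sup>+\<omega>. ennreal (f \<omega>) \<partial>M"; cases "\<integral>\<^sup>+\<omega>. ennreal (- f \<omega>) \<partial>M")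
     auto

text \<open>An integrable minorant makes the negative part integrable, so the undefined case cannot
  occur. In the optimization this is the route to admissibility of competing strategies.\<close>

lemma gen_expectation_bounded_below:
  assumes f: "f \<in> borel_measurable M" and L: "integrable M L" and le: "AE \<omega> in M. L \<omega> \<le> f \<omega>"
  shows "expectation_defined M f" "gen_expectation M f \<noteq> -\<infinity>"
proof -
  have "(\<integral>\<^sup>+\<omega>. ennreal (- f \<omega>) \<partial>M) \<le> (\<integral>\<^sup>+\<omega>. ennreal (- L \<omega>) \<partial>M)"
    using le by (intro nn_integral_mono_AE) (auto intro!: ennreal_leI)
  also have "\<dots> < \<infinity>" using L by (simp add: real_integrable_def top.not_eq_extremum)
  finally have *: "(\<integral>\<^sup>+\<omega>. ennreal (- f \<omega>) \<partial>M) < \<infinity>" .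
  then show "expectation_defined M f" using f by (simp add: expectation_defined_def)
  show "gen_expectation M f \<noteq> -\<infinity>" unfolding gen_expectation_def using *
    by (cases "\<integral>\<^sup>+\<omega>. ennreal (f \<omega>) \<partial>M"; cases "\<integral>\<^sup>+\<omega>. ennreal (- f \<omega>) \<partial>M")
       auto
qed

text \<open>Fatou's lemma for the nonnegative functions \<open>q n - L\<close>. The sign of the
  integrals of \<open>q n\<close> bounds those of \<open>q n - L\<close> by minus the integral of
  \<open>L\<close>, uniformly in \<open>n\<close>, so integrability of the limit comes as part of
  the conclusion.\<close>

lemma Fatou_integral_nonpos:
  fixes q :: "nat \<Rightarrow> 'a \<Rightarrow> real"
  assumes q: "\<And>n. integrable M (q n)" "\<And>n. (\<integral>\<omega>. q n \<omega> \<partial>M) \<le> 0"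
    and L: "integrable M L" "\<And>n \<omega>. L \<omega> \<le> q n \<omega>"
    and g: "\<And>\<omega>. (\<lambda>n. q n \<omega>) \<longlonglongrightarrow> g \<omega>"
  shows "integrable M g" "(\<integral>\<omega>. g \<omega> \<partial>M) \<le> 0"
proof -
  have gm: "g \<in> borel_measurable M"
    by (rule borel_measurable_LIMSEQ_real[where u = q]) (use q g in auto)
  have Lg: "L \<omega> \<le> g \<omega>" for \<omega>
    using g L(2) by (meson LIMSEQ_le_const)
  have "(\<integral>\<^sup>+\<omega>. ennreal (g \<omega> - L \<omega>) \<partial>M) = (\<integral>\<^sup>+\<omega>. liminf (\<lambda>n. ennreal (q n \<omega> - L \<omega>)) \<partial>M)"
    by (intro nn_integral_cong lim_imp_Liminf[symmetric] tendsto_ennrealI tendsto_diff g) auto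
  also have "\<dots> \<le> liminf (\<lambda>n. \<integral>\<^sup>+\<omega>. ennreal (q n \<omega> - L \<omega>) \<partial>M)"
    by (intro nn_integral_liminf) (use q L in auto)
  also have "\<dots> \<le> liminf (\<lambda>n::nat. ennreal (- (\<integral>\<omega>. L \<omega> \<partial>M)))"
  proof (intro Liminf_mono always_eventually allI)
    fix n
    have "(\<integral>\<^sup>+\<omega>. ennreal (q n \<omega> - L \<omega>) \<partial>M) = ennreal (\<integral>\<omega>. q n \<omega> - L \<omega> \<partial>M)"
      by (intro nn_integral_eq_integral) (use q L in auto)
    also have "\<dots> \<le> ennreal (- (\<integral>\<omega>. L \<omega> \<partial>M))"
      using q L by (intro ennreal_leI) simp
    finally show "(\<integral>\<^sup>+\<omega>. ennreal (q n \<omega> - L \<omega>) \<partial>M) \<le> ennreal (- (\<integral>\<omega>. L \<omega> \<partial>M))" .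
  qed
  finally have le: "(\<integral>\<^sup>+\<omega>. ennreal (g \<omega> - L \<omega>) \<partial>M) \<le> ennreal (- (\<integral>\<omega>. L \<omega> \<partial>M))"
    by (simp add: Liminf_const)
  have "(\<integral>\<^sup>+\<omega>. ennreal (g \<omega> - L \<omega>) \<partial>M) < \<infinity>"
    using le by (rule le_less_trans) simp
  then have "integrable M (\<lambda>\<omega>. g \<omega> - L \<omega>)"
    using gm L(1) Lg by (intro integrableI_nonneg) simp_all
  then have "integrable M (\<lambda>\<omega>. (g \<omega> - L \<omega>) + L \<omega>)"
    using L(1) by (rule Bochner_Integration.integrable_add)
  then show i: "integrable M g" by simp
  have "ennreal (\<integral>\<omega>. g \<omega> - L \<omega> \<partial>M) \<le> ennreal (- (\<integral>\<omega>. L \<omega> \<partial>M))"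
    using le by (subst (asm) nn_integral_eq_integral) (use i L Lg in auto)
  \<comment> \<open>Since \<open>ennreal\<close> truncates at 0, an inequality between
    \<open>ennreal\<close> values can be read off for the reals only once the right side is known to
    be nonnegative.\<close>
  moreover have "0 \<le> - (\<integral>\<omega>. L \<omega> \<partial>M)"
  proof -
    have "(\<integral>\<omega>. L \<omega> \<partial>M) \<le> (\<integral>\<omega>. q 0 \<omega> \<partial>M)" using q L by (intro integral_mono) auto
    then show ?thesis using q(2)[of 0] by simp
  qed
  ultimately have "(\<integral>\<omega>. g \<omega> - L \<omega> \<partial>M) \<le> - (\<integral>\<omega>. L \<omega> \<partial>M)" by simp
  then show "(\<integral>\<omega>. g \<omega> \<partial>M) \<le> 0" using i L(1) by simp
qed

text \<open>The directional derivative of expected utility at \<open>W\<close> towards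
  \<open>X\<close> is the limit of difference quotients along the segment. Concavity supplies an
  integrable minorant for all of them at once, and optimality of \<open>W\<close> on the segment
  makes their integrals nonpositive.\<close>

lemma concave_first_order_condition:
  fixes U U' :: "real \<Rightarrow> real"
  assumes U: "concave_on UNIV U" "\<And>x. (U has_real_derivative U' x) (at x)"
    and int: "integrable M (\<lambda>\<omega>. U (W \<omega>))" "integrable M (\<lambda>\<omega>. U (X \<omega>))"
    and opt: "\<And>e. 0 < e \<Longrightarrow> e \<le> 1 \<Longrightarrow> integrable M (\<lambda>\<omega>. U ((1 - e) * W \<omega> + e * X \<omega>))"
      "\<And>e. 0 < e \<Longrightarrow> e \<le> 1 \<Longrightarrow>
         (\<integral>\<omega>. U ((1 - e) * W \<omega> + e * X \<omega>) \<partial>M) \<le> (\<integral>\<omega>. U (W \<omega>) \<partial>M)"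
  shows "integrable M (\<lambda>\<omega>. U' (W \<omega>) * (X \<omega> - W \<omega>))"
    "(\<integral>\<omega>. U' (W \<omega>) * (X \<omega> - W \<omega>) \<partial>M) \<le> 0"
proof -
  define e where "e n = 1 / real (Suc n)" for n
  have e: "0 < e n" "e n \<le> 1" for n by (auto simp: e_def)
  define q where "q n \<omega> = (U ((1 - e n) * W \<omega> + e n * X \<omega>) - U (W \<omega>)) / e n" for n \<omega>
  have q: "integrable M (q n)" "(\<integral>\<omega>. q n \<omega> \<partial>M) \<le> 0" for n
    unfolding q_def using opt[OF e, of n] int(1) e[of n] by (auto simp: divide_le_0_iff)
  \<comment> \<open>The quotient at step size 1 is \<open>U (X \<omega>) - U (W \<omega>)\<close>,
    and for a concave function smaller steps can only increase it.\<close>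
  have L: "U (X \<omega>) - U (W \<omega>) \<le> q n \<omega>" for n \<omega>
  proof -
    have "(1 - e n) * U (W \<omega>) + e n * U (X \<omega>) \<le> U ((1 - e n) * W \<omega> + e n * X \<omega>)"
      using concave_onD[OF U(1), of "e n" "W \<omega>" "X \<omega>"] e[of n] by simp
    then show ?thesis using e(1)[of n] by (simp add: q_def field_simps)
  qed
  have lim: "(\<lambda>n. q n \<omega>) \<longlonglongrightarrow> U' (W \<omega>) * (X \<omega> - W \<omega>)" for \<omega>
  proof -
    have "((\<lambda>h. U (W \<omega> + h * (X \<omega> - W \<omega>))) has_real_derivative U' (W \<omega>) * (X \<omega> - W \<omega>)) (at 0)"
      by (rule DERIV_chain2[where f = U]) (use U(2) in \<open>auto intro!: derivative_eq_intros\<close>)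
    then have "((\<lambda>h. (U (W \<omega> + h * (X \<omega> - W \<omega>)) - U (W \<omega>)) / h)
                 \<longlongrightarrow> U' (W \<omega>) * (X \<omega> - W \<omega>)) (at 0)"
      by (simp add: DERIV_def)
    \<comment> \<open>The filter \<open>at 0\<close> omits the point 0 itself, so positivity of
      \<open>e n\<close> is needed besides convergence to 0.\<close>
    moreover have "filterlim e (at 0) sequentially"
      unfolding filterlim_at using LIMSEQ_inverse_real_of_nat e(1)
      by (auto simp: e_def[abs_def] inverse_eq_divide)
    ultimately have "((\<lambda>n. (U (W \<omega> + e n * (X \<omega> - W \<omega>)) - U (W \<omega>)) / e n)
                 \<longlongrightarrow> U' (W \<omega>) * (X \<omega> - W \<omega>)) sequentially"
      by (rule filterlim_compose)
    then show ?thesis by (simp add: q_def algebra_simps)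
  qed
  show "integrable M (\<lambda>\<omega>. U' (W \<omega>) * (X \<omega> - W \<omega>))"
    "(\<integral>\<omega>. U' (W \<omega>) * (X \<omega> - W \<omega>) \<partial>M) \<le> 0"
    using Fatou_integral_nonpos[OF q _ L lim] int by auto
qed

section \<open>Terminal wealth of mixed and of buy-and-hold strategies\<close>

lemma wealth_convex_combination:
  "wealth S c (\<lambda>t \<omega>. (1 - e) *\<^sub>R \<phi> t \<omega> + e *\<^sub>R \<psi> t \<omega>) T \<omega>
     = (1 - e) * wealth S c \<phi> T \<omega> + e * wealth S c \<psi> T \<omega>"
proof -
  have "(\<Sum>i=1..T. ((1 - e) *\<^sub>R \<phi> i \<omega> + e *\<^sub>R \<psi> i \<omega>) \<bullet> (S i \<omega> - S (i - 1) \<omega>))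
      = (1 - e) * (\<Sum>i=1..T. \<phi> i \<omega> \<bullet> (S i \<omega> - S (i - 1) \<omega>))
        + e * (\<Sum>i=1..T. \<psi> i \<omega> \<bullet> (S i \<omega> - S (i - 1) \<omega>))"
    by (simp add: inner_add_left sum.distrib sum_distrib_left del: sum.op_ivl_Suc)
  then show ?thesis unfolding wealth_def by (simp add: algebra_simps)
qed

text \<open>A position entered at time \<open>s\<close> and closed at time \<open>t\<close> is held
  in the periods \<open>s + 1, ..., t\<close>, whose price increments telescope. The strict
  inequality \<open>s < u\<close> is what makes the strategy predictable when \<open>h\<close> is
  known at time \<open>s\<close>.\<close>

lemma wealth_buy_and_hold:
  assumes "s \<le> t" "t \<le> T"
  shows "wealth S c (\<lambda>u \<omega>. if s < u \<and> u \<le> t then h \<omega> else 0) T \<omega> = c + h \<omega> \<bullet> (S t \<omega> - S s \<omega>)"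
proof -
  have "(\<Sum>u=1..T. (if s < u \<and> u \<le> t then h \<omega> else 0) \<bullet> (S u \<omega> - S (u - 1) \<omega>))
      = (\<Sum>u\<in>{s<..t}. h \<omega> \<bullet> (S u \<omega> - S (u - 1) \<omega>))"
    using assms by (intro sum.mono_neutral_cong_right) auto
  also have "\<dots> = h \<omega> \<bullet> (\<Sum>u\<in>{Suc s..t}. S u \<omega> - S (u - 1) \<omega>)"
    by (simp add: inner_sum_right atLeastSucAtMost_greaterThanAtMost)
  also have "(\<Sum>u\<in>{Suc s..t}. S u \<omega> - S (u - 1) \<omega>) = S t \<omega> - S s \<omega>"
    using assms(1) by (rule sum_telescope'')
  finally show ?thesis by (simp add: wealth_def)
qed

section \<open>Optimality conditions in the market\<close>

context market
begin

lemma borel_measurable_from_filtration: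
  "t \<le> T \<Longrightarrow> f \<in> borel_measurable (F t) \<Longrightarrow> f \<in> borel_measurable M"
  using measurable_from_subalg[OF subalg] by blast

lemma borel_measurable_wealth:
  assumes \<phi>: "\<phi> \<in> strategies F T"
  shows "wealth S c \<phi> T \<in> borel_measurable M"
proof -
  have "(\<lambda>\<omega>. \<phi> i \<omega> \<bullet> (S i \<omega> - S (i - 1) \<omega>)) \<in> borel_measurable M" if "i \<in> {1..T}" for i
  proof -
    have "\<phi> i \<in> borel_measurable (F (i - 1))" using \<phi> that by (simp add: strategies_def)
    then have "\<phi> i \<in> borel_measurable M" using that by (intro borel_measurable_from_filtration[of "i - 1"]) auto
    moreover have "S i \<in> borel_measurable M" "S (i - 1) \<in> borel_measurable M"
      using that by (auto intro!: borel_measurable_from_filtration[OF _ adapted])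
    ultimately show ?thesis by measurable
  qed
  then show ?thesis unfolding wealth_def[abs_def] by (intro borel_measurable_add borel_measurable_sum) auto
qed

text \<open>A competitor with bounded terminal wealth has integrable utility. This bounds the
  optimal value from below and, mixed with the optimum, gives integrable minorants for the utilities
  of all convex combinations, so that the pointwise first-order argument applies.\<close>

lemma optimal_strategy_first_order_condition:
  assumes U: "concave_on UNIV U" "mono U" "\<And>x. (U has_real_derivative U' x) (at x)"
    and opt: "optimal_strategy M F T S U c \<phi>"
    and \<psi>: "\<psi> \<in> strategies F T" "AE \<omega> in M. \<bar>wealth S c \<psi> T \<omega>\<bar> \<le> B"
  shows "integrable M (\<lambda>\<omega>. U' (wealth S c \<phi> T \<omega>) * (wealth S c \<psi> T \<omega> - wealth S c \<phi> T \<omega>))"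
    "(\<integral>\<omega>. U' (wealth S c \<phi> T \<omega>) * (wealth S c \<psi> T \<omega> - wealth S c \<phi> T \<omega>) \<partial>M) \<le> 0"
proof -
  have Um [measurable]: "U \<in> borel_measurable borel"
    using U(3) by (intro borel_measurable_continuous_onI continuous_at_imp_continuous_on)
      (auto intro: DERIV_isCont)
  have int_bounded: "integrable M (\<lambda>\<omega>. U (wealth S c \<theta> T \<omega>))"
    if "\<theta> \<in> strategies F T" "AE \<omega> in M. \<bar>wealth S c \<theta> T \<omega>\<bar> \<le> b" for \<theta> b
  proof (rule integrable_const_bound)
    show "AE \<omega> in M. norm (U (wealth S c \<theta> T \<omega>)) \<le> max \<bar>U b\<bar> \<bar>U (- b)\<bar>"
      using that(2)
    proof eventually_elim
      case (elim \<omega>)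
      then have "U (wealth S c \<theta> T \<omega>) \<le> U b" "U (- b) \<le> U (wealth S c \<theta> T \<omega>)"
        by (auto intro!: monoD[OF U(2)])
      then show ?case by simp
    qed
    show "(\<lambda>\<omega>. U (wealth S c \<theta> T \<omega>)) \<in> borel_measurable M"
      using borel_measurable_wealth[OF that(1)] by measurable
  qed
  let ?E = "\<lambda>\<theta>. gen_expectation M (\<lambda>\<omega>. U (wealth S c \<theta> T \<omega>))"
  have \<phi>: "\<phi> \<in> strategies F T" "expectation_defined M (\<lambda>\<omega>. U (wealth S c \<phi> T \<omega>))"
    and fin: "?E \<phi> < \<infinity>"
    and max: "\<And>\<theta>. \<theta> \<in> admissible M F T S U c \<Longrightarrow> ?E \<theta> \<le> ?E \<phi>"
    using opt unfolding optimal_strategy_def by (auto simp: admissible_def intro: SUP_upper)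
  \<comment> \<open>A minorant gives admissibility, admissibility gives comparison with the finite
    optimal value, and the two bounds together give integrability.\<close>
  have better: "integrable M (\<lambda>\<omega>. U (wealth S c \<theta> T \<omega>))" "?E \<theta> \<le> ?E \<phi>"
    if \<theta>: "\<theta> \<in> strategies F T" "integrable M L" "AE \<omega> in M. L \<omega> \<le> U (wealth S c \<theta> T \<omega>)" for \<theta> L
  proof -
    have "(\<lambda>\<omega>. U (wealth S c \<theta> T \<omega>)) \<in> borel_measurable M"
      using borel_measurable_wealth[OF \<theta>(1)] by measurable
    note * = gen_expectation_bounded_below[OF this \<theta>(2,3)]
    show "?E \<theta> \<le> ?E \<phi>" using \<theta>(1) *(1) by (intro max) (simp add: admissible_def)
    then show "integrable M (\<lambda>\<omega>. U (wealth S c \<theta> T \<omega>))"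
      using * fin by (intro integrable_if_gen_expectation_finite) auto
  qed
  note int_\<psi> = int_bounded[OF \<psi>]
  \<comment> \<open>The optimal value is below \<open>\<infinity>\<close> by definition of
    optimality and at least the finite expected utility of \<open>\<psi>\<close>.\<close>
  have int_\<phi>: "integrable M (\<lambda>\<omega>. U (wealth S c \<phi> T \<omega>))"
    using \<phi>(2) better(2)[OF \<psi>(1) int_\<psi>] gen_expectation_eq_integral[OF int_\<psi>] fin
    by (intro integrable_if_gen_expectation_finite) auto
  have mix: "integrable M (\<lambda>\<omega>. U ((1 - e) * wealth S c \<phi> T \<omega> + e * wealth S c \<psi> T \<omega>))"
    "(\<integral>\<omega>. U ((1 - e) * wealth S c \<phi> T \<omega> + e * wealth S c \<psi> T \<omega>) \<partial>M)
       \<le> (\<integral>\<omega>. U (wealth S c \<phi> T \<omega>) \<partial>M)"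
    if e: "0 < e" "e \<le> 1" for e
  proof -
    define \<theta> where "\<theta> t \<omega> = (1 - e) *\<^sub>R \<phi> t \<omega> + e *\<^sub>R \<psi> t \<omega>" for t \<omega>
    have w: "wealth S c \<theta> T \<omega> = (1 - e) * wealth S c \<phi> T \<omega> + e * wealth S c \<psi> T \<omega>" for \<omega>
      unfolding \<theta>_def by (rule wealth_convex_combination)
    have "\<theta> \<in> strategies F T"
      using \<phi>(1) \<psi>(1) unfolding strategies_def \<theta>_def[abs_def]
      by (auto intro!: borel_measurable_add borel_measurable_scaleR)
    moreover have "integrable M (\<lambda>\<omega>. (1 - e) * U (wealth S c \<phi> T \<omega>) + e * U (wealth S c \<psi> T \<omega>))"
      using int_\<phi> int_\<psi> by simp
    moreover have "AE \<omega> in M. (1 - e) * U (wealth S c \<phi> T \<omega>) + e * U (wealth S c \<psi> T \<omega>)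
        \<le> U (wealth S c \<theta> T \<omega>)"
      using concave_onD[OF U(1)] e unfolding w by simp
    ultimately have *: "integrable M (\<lambda>\<omega>. U (wealth S c \<theta> T \<omega>))" "?E \<theta> \<le> ?E \<phi>"
      by (rule better)+
    show "integrable M (\<lambda>\<omega>. U ((1 - e) * wealth S c \<phi> T \<omega> + e * wealth S c \<psi> T \<omega>))"
      "(\<integral>\<omega>. U ((1 - e) * wealth S c \<phi> T \<omega> + e * wealth S c \<psi> T \<omega>) \<partial>M)
       \<le> (\<integral>\<omega>. U (wealth S c \<phi> T \<omega>) \<partial>M)"
      using * gen_expectation_eq_integral[OF int_\<phi>] gen_expectation_eq_integral[OF *(1)]
      unfolding w by simp_all
  qed
  show "integrable M (\<lambda>\<omega>. U' (wealth S c \<phi> T \<omega>) * (wealth S c \<psi> T \<omega> - wealth S c \<phi> T \<omega>))"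
    "(\<integral>\<omega>. U' (wealth S c \<phi> T \<omega>) * (wealth S c \<psi> T \<omega> - wealth S c \<phi> T \<omega>) \<partial>M) \<le> 0"
    by (rule concave_first_order_condition[OF U(1,3) int_\<phi> int_\<psi> mix]; assumption)+
qed

lemma integrable_marginal_utility:
  assumes U: "concave_on UNIV U" "strict_mono U" "\<And>x. (U has_real_derivative U' x) (at x)"
      "U' \<in> borel_measurable borel"
    and opt: "optimal_strategy M F T S U c \<phi>"
  shows "integrable M (\<lambda>\<omega>. U' (wealth S c \<phi> T \<omega>))"
proof -
  let ?W = "wealth S c \<phi> T"
  note [measurable] = U(4)
  have m: "mono U" using U(2) by (rule strict_mono_mono)
  have [measurable]: "?W \<in> borel_measurable M"
    using opt by (intro borel_measurable_wealth) (auto simp: optimal_strategy_def admissible_def)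
  \<comment> \<open>The competitor here is the strategy that never trades; its wealth is the
    constant \<open>c\<close>.\<close>
  have w0: "wealth S c (\<lambda>_ _. 0) T = (\<lambda>_. c)" by (simp add: wealth_def fun_eq_iff)
  have "integrable M (\<lambda>\<omega>. U' (?W \<omega>) * (c - ?W \<omega>))"
    using optimal_strategy_first_order_condition(1)[OF U(1) m U(3) opt, of "\<lambda>_ _. 0" "\<bar>c\<bar>"]
    unfolding w0 by (simp add: strategies_def)
  then have "integrable M (\<lambda>\<omega>. \<bar>U' (?W \<omega>) * (c - ?W \<omega>)\<bar> + (U (c + 1) - U (c - 2)))"
    by simp
  then show ?thesis
  proof (rule Bochner_Integration.integrable_bound)
    show "AE \<omega> in M. norm (U' (?W \<omega>)) \<le> norm (\<bar>U' (?W \<omega>) * (c - ?W \<omega>)\<bar> + (U (c + 1) - U (c - 2)))"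
    proof (rule AE_I2)
      fix \<omega>
      have "0 \<le> U' (?W \<omega>)"
        using concave_strict_mono_derivative_pos[OF U(1-3)] by (rule less_imp_le)
      with concave_mono_derivative_le[OF U(1) m U(3) this, of c]
      show "norm (U' (?W \<omega>)) \<le> norm (\<bar>U' (?W \<omega>) * (c - ?W \<omega>)\<bar> + (U (c + 1) - U (c - 2)))"
        by simp
    qed
  qed simp
qed

text \<open>Bounded gains can be added to the capital in any multiple of either sign, which turns
  the one-sided first-order condition into an equality. Taking for \<open>h\<close> an indicator
  times a unit vector later yields the martingale property.\<close>

lemma marginal_utility_orthogonal:
  assumes U: "concave_on UNIV U" "strict_mono U" "\<And>x. (U has_real_derivative U' x) (at x)"
      "U' \<in> borel_measurable borel"
    and opt: "optimal_strategy M F T S U c \<phi>"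
    and bdd: "bounded_process M T S"
    and st: "s \<le> t" "t \<le> T"
    and h: "h \<in> borel_measurable (F s)" "\<And>\<omega>. norm (h \<omega>) \<le> 1"
  shows "(\<integral>\<omega>. U' (wealth S c \<phi> T \<omega>) * (h \<omega> \<bullet> (S t \<omega> - S s \<omega>)) \<partial>M) = 0"
proof -
  let ?W = "wealth S c \<phi> T"
  define Y where "Y \<omega> = h \<omega> \<bullet> (S t \<omega> - S s \<omega>)" for \<omega>
  note [measurable] = U(4)
  have m: "mono U" using U(2) by (rule strict_mono_mono)
  have [measurable]: "?W \<in> borel_measurable M"
    using opt by (intro borel_measurable_wealth) (auto simp: optimal_strategy_def admissible_def)
  have [measurable]: "Y \<in> borel_measurable M"
    unfolding Y_def[abs_def] using st h(1) adapted[of t] adapted[of s]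
      borel_measurable_from_filtration[of s] borel_measurable_from_filtration[of t]
    by (intro borel_measurable_inner borel_measurable_diff) auto
  obtain K where K: "\<And>t. t \<le> T \<Longrightarrow> AE \<omega> in M. norm (S t \<omega>) \<le> K"
    using bdd unfolding bounded_process_def by blast
  have Y: "AE \<omega> in M. \<bar>Y \<omega>\<bar> \<le> 2 * K"
    using K[OF st(2)] K[OF order_trans[OF st]]
  proof eventually_elim
    case (elim \<omega>)
    have "\<bar>Y \<omega>\<bar> \<le> norm (h \<omega>) * norm (S t \<omega> - S s \<omega>)"
      unfolding Y_def by (rule Cauchy_Schwarz_ineq2)
    also have "\<dots> \<le> 1 * norm (S t \<omega> - S s \<omega>)" by (intro mult_right_mono h) simp
    also have "\<dots> \<le> norm (S t \<omega>) + norm (S s \<omega>)" using norm_triangle_ineq4 by simp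
    finally show ?case using elim by simp
  qed
  note int_U' = integrable_marginal_utility[OF U opt]
  have int_Y: "integrable M (\<lambda>\<omega>. U' (?W \<omega>) * Y \<omega>)"
  proof (rule Bochner_Integration.integrable_bound)
    show "integrable M (\<lambda>\<omega>. U' (?W \<omega>) * (2 * K))" using int_U' by simp
    show "AE \<omega> in M. norm (U' (?W \<omega>) * Y \<omega>) \<le> norm (U' (?W \<omega>) * (2 * K))"
      using Y by eventually_elim (auto simp: abs_mult intro!: mult_left_mono)
  qed simp
  define D where "D = (\<integral>\<omega>. U' (?W \<omega>) * (c - ?W \<omega>) \<partial>M)"
  \<comment> \<open>The directions \<open>c + r Y - W\<close> are all feasible, and the \<open>r\<close>-linear term
    must not dominate as \<open>r \<rightarrow> \<plusminus>\<infinity>\<close>.\<close>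
  have le: "D + r * (\<integral>\<omega>. U' (?W \<omega>) * Y \<omega> \<partial>M) \<le> 0" for r
  proof -
    define \<psi> where "\<psi> u \<omega> = (if s < u \<and> u \<le> t then r *\<^sub>R h \<omega> else 0)" for u \<omega>
    have w: "wealth S c \<psi> T \<omega> = c + r * Y \<omega>" for \<omega>
      unfolding \<psi>_def Y_def using wealth_buy_and_hold[OF st, of S c "\<lambda>\<omega>. r *\<^sub>R h \<omega>"] by simp
    have \<psi>: "\<psi> \<in> strategies F T" unfolding strategies_def
    proof (intro CollectI ballI)
      fix u assume u: "u \<in> {1..T}"
      show "\<psi> u \<in> borel_measurable (F (u - 1))"
      proof (cases "s < u \<and> u \<le> t")
        case True
        \<comment> \<open>In a period \<open>u\<close> with \<open>s < u\<close>, the information at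
          time \<open>s\<close> is already available at time \<open>u - 1\<close>.\<close>
        have "subalgebra (F (u - 1)) (F s)"
        proof -
          have "s \<le> u - 1" "u - 1 \<le> T" "s \<le> T" using True u st by auto
          then show ?thesis
            using subalg[of s] subalg[of "u - 1"] filtration_mono[of s "u - 1"]
            by (simp add: subalgebra_def)
        qed
        then have "h \<in> borel_measurable (F (u - 1))" using h(1) by (rule measurable_from_subalg)
        with True show ?thesis by (simp add: \<psi>_def[abs_def])
      next
        case False
        then have "\<psi> u = (\<lambda>_. 0)" by (auto simp: \<psi>_def fun_eq_iff)
        then show ?thesis by simp
      qed
    qed
    have "AE \<omega> in M. \<bar>wealth S c \<psi> T \<omega>\<bar> \<le> \<bar>c\<bar> + \<bar>r\<bar> * (2 * K)"
      using Y
    proof eventually_elim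
      case (elim \<omega>)
      have "\<bar>c + r * Y \<omega>\<bar> \<le> \<bar>c\<bar> + \<bar>r\<bar> * \<bar>Y \<omega>\<bar>" by (metis abs_triangle_ineq abs_mult)
      also have "\<dots> \<le> \<bar>c\<bar> + \<bar>r\<bar> * (2 * K)" using elim by (intro add_left_mono mult_left_mono) auto
      finally show ?case by (simp add: w)
    qed
    from optimal_strategy_first_order_condition[OF U(1) m U(3) opt \<psi> this]
    have *: "integrable M (\<lambda>\<omega>. U' (?W \<omega>) * (c + r * Y \<omega> - ?W \<omega>))"
      "(\<integral>\<omega>. U' (?W \<omega>) * (c + r * Y \<omega> - ?W \<omega>) \<partial>M) \<le> 0"
      by (simp_all add: w)
    \<comment> \<open>Subtracting the gain term from the competitor's integrand leaves that of
      \<open>D\<close>; both functions subtracted here are already known to be integrable.\<close>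
    have "(\<integral>\<omega>. U' (?W \<omega>) * (c + r * Y \<omega> - ?W \<omega>) - r * (U' (?W \<omega>) * Y \<omega>) \<partial>M)
        = (\<integral>\<omega>. U' (?W \<omega>) * (c + r * Y \<omega> - ?W \<omega>) \<partial>M) - r * (\<integral>\<omega>. U' (?W \<omega>) * Y \<omega> \<partial>M)"
      using *(1) int_Y by simp
    moreover have "(\<lambda>\<omega>. U' (?W \<omega>) * (c + r * Y \<omega> - ?W \<omega>) - r * (U' (?W \<omega>) * Y \<omega>))
        = (\<lambda>\<omega>. U' (?W \<omega>) * (c - ?W \<omega>))" by (simp add: fun_eq_iff algebra_simps)
    ultimately show ?thesis using *(2) unfolding D_def by simp
  qed
  have "(\<integral>\<omega>. U' (?W \<omega>) * Y \<omega> \<partial>M) = 0"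
  proof (rule ccontr)
    assume "(\<integral>\<omega>. U' (?W \<omega>) * Y \<omega> \<partial>M) \<noteq> 0"
    \<comment> \<open>This multiple is chosen so that the left side of \<open>le\<close> equals
      1.\<close>
    with le[of "(1 - D) / (\<integral>\<omega>. U' (?W \<omega>) * Y \<omega> \<partial>M)"] show False by simp
  qed
  then show ?thesis by (simp add: Y_def)
qed

end

section \<open>Change of measure and the martingale property\<close>

text \<open>The null sets of the first argument are null for the second, so this is the half of
  equivalence that rests on strict positivity: on a null set of the density measure \<open>f\<close>
  would have to vanish almost everywhere.\<close>

lemma absolutely_continuous_density_positive:
  fixes f :: "'a \<Rightarrow> real"
  assumes "f \<in> borel_measurable M" "\<And>\<omega>. 0 < f \<omega>"
  shows "absolutely_continuous (density M (\<lambda>\<omega>. ennreal (f \<omega>))) M"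
proof -
  have "A \<in> null_sets M" if "A \<in> null_sets (density M (\<lambda>\<omega>. ennreal (f \<omega>)))" for A
  proof -
    have "A \<in> sets M" "AE \<omega> in M. \<omega> \<in> A \<longrightarrow> ennreal (f \<omega>) = 0"
      using that assms(1) by (simp_all add: null_sets_density_iff)
    moreover have "ennreal (f \<omega>) \<noteq> 0" for \<omega>
      using assms(2)[of \<omega>] by (simp add: ennreal_eq_0_iff not_le)
    ultimately show ?thesis by (simp add: AE_iff_null_sets)
  qed
  then show ?thesis unfolding absolutely_continuous_def by blast
qed

text \<open>A conditional expectation is determined by its integrals over the sets of the smaller
  \<sigma>-algebra, so orthogonality has to be tested only with indicators of such sets times unit
  vectors.\<close>

lemma (in market) martingale_density:
  assumes Z: "Z \<in> borel_measurable M" "\<And>\<omega>. 0 \<le> Z \<omega>"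
    and Q: "prob_space (density M (\<lambda>\<omega>. ennreal (Z \<omega>)))"
    and bdd: "bounded_process M T S"
    and orth: "\<And>s t h. s \<le> t \<Longrightarrow> t \<le> T \<Longrightarrow> h \<in> borel_measurable (F s) \<Longrightarrow> (\<And>\<omega>. norm (h \<omega>) \<le> 1) \<Longrightarrow>
          (\<integral>\<omega>. Z \<omega> * (h \<omega> \<bullet> (S t \<omega> - S s \<omega>)) \<partial>M) = 0"
  shows "is_martingale (density M (\<lambda>\<omega>. ennreal (Z \<omega>))) F T S"
proof -
  let ?Q = "density M (\<lambda>\<omega>. ennreal (Z \<omega>))"
  interpret Q: prob_space ?Q by (rule Q)
  note [measurable] = Z(1)
  obtain K where K: "\<And>t. t \<le> T \<Longrightarrow> AE \<omega> in M. norm (S t \<omega>) \<le> K"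
    using bdd unfolding bounded_process_def by blast
  have Sm: "S t \<in> borel_measurable M" if "t \<le> T" for t
    using that by (intro borel_measurable_from_filtration[OF _ adapted])
  have int: "integrable ?Q (S t)" if "t \<le> T" for t
  proof (rule Q.integrable_const_bound)
    show "AE \<omega> in ?Q. norm (S t \<omega>) \<le> K"
      using K[OF that] by (simp add: AE_density) (auto elim: eventually_mono)
    show "S t \<in> borel_measurable ?Q" using Sm[OF that] by simp
  qed
  have "AE \<omega> in ?Q. real_cond_exp ?Q (F s) (\<lambda>\<omega>. S t \<omega> $ i) \<omega> = S s \<omega> $ i"
    if st: "s \<le> t" "t \<le> T" for s t i
  proof -
    have s: "s \<le> T" using st by simp
    have "subalgebra ?Q (F s)" using subalg[OF s] by (simp add: subalgebra_def)
    then have sub: "sigma_finite_subalgebra ?Q (F s)"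
      by (intro finite_measure_subalgebra_is_sigma_finite finite_measure_subalgebra.intro
          finite_measure_subalgebra_axioms.intro Q.finite_measure_axioms)
    have inti: "integrable ?Q (\<lambda>\<omega>. S t \<omega> $ i)" if "t \<le> T" for t
      using integrable_inner_left[OF int[OF that], of "axis i 1"] by (simp add: inner_axis)
    show ?thesis
    proof (rule sigma_finite_subalgebra.real_cond_exp_charact[OF sub _ inti[OF st(2)] inti[OF s]])
      fix A assume A: "A \<in> sets (F s)"
      then have AM: "A \<in> sets M" using subalg[OF s] by (auto simp: subalgebra_def)
      \<comment> \<open>This holds one unit of asset \<open>i\<close> on the event \<open>A\<close>,
        so its gain between \<open>s\<close> and \<open>t\<close> is the increment of the
        \<open>i\<close>-th price restricted to \<open>A\<close>.\<close>
      define h :: "'a \<Rightarrow> real ^ 'd" where "h \<omega> = indicator A \<omega> *\<^sub>R axis i 1" for \<omega>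
      have "(\<integral>\<omega>\<in>A. S t \<omega> $ i \<partial>?Q) - (\<integral>\<omega>\<in>A. S s \<omega> $ i \<partial>?Q)
          = (\<integral>\<omega>\<in>A. (S t \<omega> $ i - S s \<omega> $ i) \<partial>?Q)"
        unfolding set_lebesgue_integral_def using inti[OF st(2)] inti[OF s] AM
        by (subst Bochner_Integration.integral_diff[symmetric])
           (auto simp: right_diff_distrib intro!: integrable_mult_indicator[where 'b = real, simplified])
      also have "\<dots> = (\<integral>\<omega>. h \<omega> \<bullet> (S t \<omega> - S s \<omega>) \<partial>?Q)"
        unfolding set_lebesgue_integral_def h_def by (simp add: inner_axis' inner_axis)
      also have "\<dots> = (\<integral>\<omega>. Z \<omega> * (h \<omega> \<bullet> (S t \<omega> - S s \<omega>)) \<partial>M)"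
        using Z Sm[OF s] Sm[OF st(2)] AM by (intro integral_real_density) (auto simp: h_def)
      also have "\<dots> = 0"
      proof (rule orth[OF st])
        show "h \<in> borel_measurable (F s)" unfolding h_def[abs_def] using A by simp
        show "norm (h \<omega>) \<le> 1" for \<omega> by (simp add: h_def indicator_def)
      qed
      finally show "(\<integral>\<omega>\<in>A. S t \<omega> $ i \<partial>?Q) = (\<integral>\<omega>\<in>A. S s \<omega> $ i \<partial>?Q)" by simp
    next
      show "(\<lambda>\<omega>. S s \<omega> $ i) \<in> borel_measurable (F s)"
        using borel_measurable_inner[OF adapted[OF s] borel_measurable_const[of "axis i 1"]]
        by (simp add: inner_axis)
    qed
  qed
  then show ?thesis unfolding is_martingale_def using adapted int by blast
qed

theorem theorem6p2:
  fixes M :: "'a measure" and F :: "nat \<Rightarrow> 'a measure" and T :: nat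
    and S :: "nat \<Rightarrow> 'a \<Rightarrow> real ^ 'd" and U :: "real \<Rightarrow> real"
    and c :: real and \<phi> :: "nat \<Rightarrow> 'a \<Rightarrow> real ^ 'd"
  assumes "market M F T S"
    and "assumption_B U \<or> assumption_C U"
    and "strict_mono U"
    and "U C1_differentiable_on UNIV"
    and "no_arbitrage M F T S"
    and "bounded_process M T S"
    and "well_posed M F T S U"
    and "optimal_strategy M F T S U c \<phi>"
  shows "integrable M (\<lambda>\<omega>. deriv U (wealth S c \<phi> T \<omega>)) \<and>
         (\<integral>\<omega>. deriv U (wealth S c \<phi> T \<omega>) \<partial>M) > 0 \<and>
         equivalent_martingale_measure M F T S
           (density M (\<lambda>\<omega>. ennreal (deriv U (wealth S c \<phi> T \<omega>)
                                    / (\<integral>\<omega>'. deriv U (wealth S c \<phi> T \<omega>') \<partial>M))))"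
proof -
  interpret market M F T S by (rule assms(1))
  let ?W = "wealth S c \<phi> T"
  have U: "concave_on UNIV U" using assms(2) by (auto simp: assumption_B_def assumption_C_def)
  obtain D where D: "\<And>x. (U has_vector_derivative D x) (at x)" "continuous_on UNIV D"
    using assms(4) unfolding C1_differentiable_on_def by auto
  have dU: "(U has_real_derivative deriv U x) (at x)" for x
    using D(1)[of x] DERIV_imp_deriv by (metis has_real_derivative_iff_has_vector_derivative)
  \<comment> \<open>Identifying \<open>deriv U\<close> with the continuous derivative
    \<open>D\<close> makes the marginal utility measurable.\<close>
  have "deriv U = D"
    using D(1) DERIV_imp_deriv by (metis ext has_real_derivative_iff_has_vector_derivative)
  then have dm [measurable]: "deriv U \<in> borel_measurable borel"
    using D(2) by (simp add: borel_measurable_continuous_onI)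
  have Wm [measurable]: "?W \<in> borel_measurable M"
    using assms(8) by (intro borel_measurable_wealth) (auto simp: optimal_strategy_def admissible_def)
  have pos: "0 < deriv U x" for x
    by (rule concave_strict_mono_derivative_pos[OF U assms(3) dU])
  have int: "integrable M (\<lambda>\<omega>. deriv U (?W \<omega>))"
    by (rule integrable_marginal_utility[OF U assms(3) dU dm assms(8)])
  define m where "m = (\<integral>\<omega>. deriv U (?W \<omega>) \<partial>M)"
  have m: "0 < m"
  proof -
    have "0 \<le> m" unfolding m_def using pos by (intro integral_nonneg_AE) (auto intro: less_imp_le)
    \<comment> \<open>A nonnegative function with zero integral vanishes almost everywhere;
      \<open>deriv U\<close> vanishes nowhere, and a probability space is not a null set.\<close>
    moreover have "m \<noteq> 0"
    proof
      assume "m = 0"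
      then have "AE \<omega> in M. deriv U (?W \<omega>) = 0"
        using int pos unfolding m_def by (subst (asm) integral_nonneg_eq_0_iff_AE) (auto intro: less_imp_le)
      then have "AE \<omega> in M. False" by eventually_elim (use pos in \<open>metis less_irrefl\<close>)
      then show False by simp
    qed
    ultimately show ?thesis by simp
  qed
  define Z where "Z \<omega> = deriv U (?W \<omega>) / m" for \<omega>
  have Z: "0 < Z \<omega>" for \<omega> using pos m by (simp add: Z_def)
  have [measurable]: "Z \<in> borel_measurable M" unfolding Z_def[abs_def] by measurable
  let ?Q = "density M (\<lambda>\<omega>. ennreal (Z \<omega>))"
  have "emeasure ?Q (space ?Q) = (\<integral>\<^sup>+\<omega>. ennreal (Z \<omega>) \<partial>M)"
    by (subst emeasure_density) (auto intro!: nn_integral_cong)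
  also have "\<dots> = ennreal (\<integral>\<omega>. Z \<omega> \<partial>M)"
    using int Z by (intro nn_integral_eq_integral) (auto simp: Z_def[abs_def] intro!: less_imp_le)
  also have "(\<integral>\<omega>. Z \<omega> \<partial>M) = 1" using m by (simp add: Z_def[abs_def] m_def)
  finally have Q: "prob_space ?Q" by (intro prob_spaceI) simp
  have "is_martingale ?Q F T S"
  proof (rule martingale_density[OF _ less_imp_le[OF Z] Q assms(6)])
    fix s t :: nat and h :: "'a \<Rightarrow> real ^ 'd"
    assume st: "s \<le> t" "t \<le> T" and h: "h \<in> borel_measurable (F s)" "\<And>\<omega>. norm (h \<omega>) \<le> 1"
    \<comment> \<open>Normalization only rescales the integral by \<open>1 / m\<close>, so
      orthogonality passes from the marginal utility to the density.\<close>
    have "(\<integral>\<omega>. Z \<omega> * (h \<omega> \<bullet> (S t \<omega> - S s \<omega>)) \<partial>M)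
        = (\<integral>\<omega>. deriv U (?W \<omega>) * (h \<omega> \<bullet> (S t \<omega> - S s \<omega>)) \<partial>M) / m"
      by (simp add: Z_def)
    also have "\<dots> = 0"
      using marginal_utility_orthogonal[OF U assms(3) dU dm assms(8,6) st h] by simp
    finally show "(\<integral>\<omega>. Z \<omega> * (h \<omega> \<bullet> (S t \<omega> - S s \<omega>)) \<partial>M) = 0" .
  qed simp
  moreover have "absolutely_continuous M ?Q" by (intro absolutely_continuousI_density) simp
  moreover have "absolutely_continuous ?Q M" using Z by (intro absolutely_continuous_density_positive) simp
  ultimately have "equivalent_martingale_measure M F T S ?Q"
    unfolding equivalent_martingale_measure_def using Q by simp
  then show ?thesis using int m unfolding Z_def m_def by simp
qed

end
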